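(* Let $A\in\mathbb{R}^{m\times n}$, $b\in\mathbb{R}^m$, $\sigma\ge 0$. Suppose that $\{x\in\mathbb{R}^n:\|Ax-b\|_2\le\sigma\}$ is nonempty. Then there exists $\lambda^*>0$ such that for every $\lambda>\lambda^*$ the penalty problem $$\min\{\|x\|_0+\tfrac{\lambda}{2}(\|Ax-b\|_2-\sigma)_+^2:x\in\mathbb{R}^n\}$$ has the same optimal solution set as the constrained problem $\min\{\|x\|_0:\|Ax-b\|_2\le\sigma,\ x\in\mathbb{R}^n\}$.
   Context: $\|x\|_0$ is the number of nonzero components of $x$; for $z\in\mathbb{R}$, $z_+:=z$ if $z>0$ and $z_+:=0$ otherwise, and $(\cdot)_+^2$ is the square of the positive part; "optimal solution set" means the set of all global minimizers. *)

theory Defs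
  imports "HOL-Analysis.Analysis"
begin

definition l0_norm :: "real ^ 'n \<Rightarrow> nat" where
  "l0_norm x = card {i. x $ i \<noteq> 0}"

definition pos_part :: "real \<Rightarrow> real" where
  "pos_part z = (if z > 0 then z else 0)"

definition optimal_solutions :: "('a \<Rightarrow> real) \<Rightarrow> 'a set \<Rightarrow> 'a set" where
  "optimal_solutions f S = {x. is_arg_min f (\<lambda>y. y \<in> S) x}"

definition feasible_set :: "real ^ 'n ^ 'm \<Rightarrow> real ^ 'm \<Rightarrow> real \<Rightarrow> (real ^ 'n) set" where
  "feasible_set A b \<sigma> = {x. norm (A *v x - b) \<le> \<sigma>}"

definition penalty_objective ::
  "real ^ 'n ^ 'm \<Rightarrow> real ^ 'm \<Rightarrow> real \<Rightarrow> real \<Rightarrow> real ^ 'n \<Rightarrow> real" where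
  "penalty_objective A b \<sigma> lam x =
     real (l0_norm x) + lam / 2 * (pos_part (norm (A *v x - b) - \<sigma>))\<^sup>2"

end

theory Submission
  imports Defs
begin

text \<open>
  Let \<open>k\<close> be the least sparsity of a feasible point. The vectors with fewer than \<open>k\<close> nonzero
  entries form a finite union of coordinate subspaces, so their image under \<open>A\<close> is closed and its
  distance to \<open>b\<close> is attained; as none of these vectors is feasible, that distance exceeds \<open>\<sigma>\<close> by
  some \<open>\<delta> > 0\<close>. Once \<open>\<lambda> \<delta>\<^sup>2 / 2 > k\<close>, every infeasible vector has penalty objective above \<open>k\<close>:
  through the penalty term if it is sparser than \<open>k\<close>, and through the sparsity term plus a
  positive penalty otherwise.
\<close>

text \<open>A linear image of a closed set can fail to be closed, so the argument goes through
  supports: for each of the finitely many \<open>S\<close>, the image of a coordinate subspace is a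
  subspace, hence closed.\<close>

lemma closed_image_sparse:
  fixes A :: "real ^ 'n ^ 'm"
  shows "closed ((*v) A ` {x. l0_norm x < k})"
proof -
  have eq: "{x :: real ^ 'n. l0_norm x < k} =
      (\<Union>S\<in>{S. card S < k}. {x. \<forall>i. i \<notin> S \<longrightarrow> x $ i = 0})"
  proof (intro set_eqI iffI)
    fix x :: "real ^ 'n"
    assume "x \<in> {x. l0_norm x < k}"
    then show "x \<in> (\<Union>S\<in>{S. card S < k}. {x. \<forall>i. i \<notin> S \<longrightarrow> x $ i = 0})"
      by (auto simp: l0_norm_def intro!: exI[of _ "{i. x $ i \<noteq> 0}"])
  next
    fix x :: "real ^ 'n"
    assume "x \<in> (\<Union>S\<in>{S. card S < k}. {x. \<forall>i. i \<notin> S \<longrightarrow> x $ i = 0})"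
    then obtain S where "card S < k" "{i. x $ i \<noteq> 0} \<subseteq> S"
      by auto
    then have "card {i. x $ i \<noteq> 0} < k"
      by (meson card_mono finite le_less_trans)
    then show "x \<in> {x. l0_norm x < k}"
      by (simp add: l0_norm_def)
  qed
  have "closed ((*v) A ` {x. \<forall>i. i \<notin> S \<longrightarrow> x $ i = 0})" for S
  proof -
    have "subspace {x :: real ^ 'n. \<forall>i. i \<notin> S \<longrightarrow> x $ i = 0}"
      by (auto simp: subspace_def)
    then show ?thesis
      by (intro closed_subspace linear_subspace_image matrix_vector_mul_linear)
  qed
  then show ?thesis
    unfolding eq image_UN by (intro closed_UN) auto
qed

text \<open>Closedness of the image makes the distance from \<open>b\<close> attained, which turns
  pointwise strict inequalities into one uniform gap.\<close>

lemma sparse_residual_gap: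
  fixes A :: "real ^ 'n ^ 'm"
  assumes "\<And>x. l0_norm x < k \<Longrightarrow> norm (A *v x - b) > \<sigma>"
  obtains \<delta> where "\<delta> > 0" "\<And>x. l0_norm x < k \<Longrightarrow> norm (A *v x - b) \<ge> \<sigma> + \<delta>"
proof (cases "{x :: real ^ 'n. l0_norm x < k} = {}")
  case True
  \<comment> \<open>This is \<open>k = 0\<close>: the claim is vacuous and any positive gap
    serves.\<close>
  then show ?thesis
    by (intro that[of 1]) auto
next
  case False
  then obtain y where y: "y \<in> (*v) A ` {x. l0_norm x < k}"
    "\<And>z. z \<in> (*v) A ` {x. l0_norm x < k} \<Longrightarrow> dist b y \<le> dist b z"
    using distance_attains_inf[OF closed_image_sparse, of A k b] by blast
  have "norm (A *v x - b) \<ge> dist b y" if "l0_norm x < k" for x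
    using y(2)[of "A *v x"] that by (simp add: dist_norm norm_minus_commute)
  moreover have "dist b y > \<sigma>"
    using y(1) assms by (auto simp: dist_norm norm_minus_commute)
  ultimately show ?thesis
    by (intro that[of "dist b y - \<sigma>"]) auto
qed

lemma penalty_objective_feasible:
  "x \<in> feasible_set A b \<sigma> \<Longrightarrow> penalty_objective A b \<sigma> lam x = real (l0_norm x)"
  by (simp add: feasible_set_def penalty_objective_def pos_part_def)

text \<open>Both solution sets are the sublevel set at the common minimum \<open>g x0\<close>;
  strictness outside \<open>S\<close> keeps infeasible points from tying.\<close>

lemma optimal_solutions_UNIV_eq:
  assumes "x0 \<in> S" "\<And>x. x \<in> S \<Longrightarrow> f x = g x" "\<And>x. x \<notin> S \<Longrightarrow> f x > g x0"
    "\<And>x. x \<in> S \<Longrightarrow> g x0 \<le> g x"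
  shows "optimal_solutions f UNIV = optimal_solutions g S"
proof -
  have "f x0 \<le> f y" for y
    using assms by (cases "y \<in> S") (auto simp: less_imp_le)
  then have "optimal_solutions f UNIV = {x. f x \<le> f x0}"
    unfolding optimal_solutions_def is_arg_min_linorder by (auto intro: order_trans)
  also have "\<dots> = {x \<in> S. g x \<le> g x0}"
    using assms(1-3) by (metis linorder_not_le)
  also have "\<dots> = optimal_solutions g S"
    unfolding optimal_solutions_def is_arg_min_linorder
    using assms(1,4) by (auto intro: order_trans)
  finally show ?thesis .
qed

theorem proposition5p5:
  fixes A :: "real ^ 'n ^ 'm" and b :: "real ^ 'm" and \<sigma> :: real
  assumes "\<sigma> \<ge> 0"
    and "feasible_set A b \<sigma> \<noteq> {}"
  shows "\<exists>lam0 > 0. \<forall>lam > lam0.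
    optimal_solutions (penalty_objective A b \<sigma> lam) UNIV =
    optimal_solutions (\<lambda>x. real (l0_norm x)) (feasible_set A b \<sigma>)"
proof -
  obtain x0 where x0: "x0 \<in> feasible_set A b \<sigma>"
    "\<And>x. x \<in> feasible_set A b \<sigma> \<Longrightarrow> l0_norm x0 \<le> l0_norm x"
    using assms(2) ex_has_least_nat[of "\<lambda>x. x \<in> feasible_set A b \<sigma>" _ l0_norm] by blast
  have "norm (A *v x - b) > \<sigma>" if "l0_norm x < l0_norm x0" for x
    using x0(2)[of x] that by (force simp: feasible_set_def)
  then obtain \<delta> where \<delta>: "\<delta> > 0"
    "\<And>x. l0_norm x < l0_norm x0 \<Longrightarrow> norm (A *v x - b) \<ge> \<sigma> + \<delta>"
    using sparse_residual_gap[of "l0_norm x0" \<sigma> A b] by metis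
  \<comment> \<open>Chosen so that \<open>lam0 / 2 * \<delta>\<^sup>2\<close> equals
    \<open>l0_norm x0 + 1\<close>; the \<open>+ 1\<close> keeps \<open>lam0\<close> positive even if
    \<open>x0 = 0\<close>.\<close>
  define lam0 where "lam0 = 2 * (real (l0_norm x0) + 1) / \<delta>\<^sup>2"
  have "lam0 > 0"
    using \<delta>(1) by (simp add: lam0_def)
  moreover have "optimal_solutions (penalty_objective A b \<sigma> lam) UNIV =
      optimal_solutions (\<lambda>x. real (l0_norm x)) (feasible_set A b \<sigma>)" if lam: "lam > lam0" for lam
  proof (rule optimal_solutions_UNIV_eq[OF x0(1)])
    fix x
    assume "x \<notin> feasible_set A b \<sigma>"
    then have infeasible: "norm (A *v x - b) > \<sigma>"
      by (simp add: feasible_set_def)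
    have "lam > 0"
      using lam \<open>lam0 > 0\<close> by simp
    show "real (l0_norm x0) < penalty_objective A b \<sigma> lam x"
    proof (cases "l0_norm x < l0_norm x0")
      case True
      have "real (l0_norm x0) < lam0 / 2 * \<delta>\<^sup>2"
        using \<delta>(1) by (simp add: lam0_def)
      also have "\<dots> \<le> lam / 2 * (norm (A *v x - b) - \<sigma>)\<^sup>2"
        using lam \<open>lam > 0\<close> \<delta>(1) \<delta>(2)[OF True] by (intro mult_mono power_mono) auto
      finally show ?thesis
        using infeasible by (simp add: penalty_objective_def pos_part_def)
    next
      case False
      \<comment> \<open>Since \<open>l0_norm x\<close> may equal \<open>l0_norm x0\<close>,
        strictness has to come from the penalty.\<close>
      moreover have "lam / 2 * (norm (A *v x - b) - \<sigma>)\<^sup>2 > 0"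
        using infeasible \<open>lam > 0\<close> by simp
      ultimately show ?thesis
        using infeasible by (simp add: penalty_objective_def pos_part_def)
    qed
  qed (use x0(2) in \<open>auto simp: penalty_objective_feasible\<close>)
  ultimately show ?thesis
    by blast
qed

end
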